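(* There is a family $\mathcal{A}$ of subsets of $\omega_1$, with $|\mathcal{A}| = 2^{\omega_1}$, such that: (1) if $S$ and $T$ are distinct elements of $\mathcal{A}$, then $C_k(S)$ is not a continuous open image of $C_k(T)$ and $C_k(S)$ does not embed in $C_k(T)$; and (2) if $S$ and $T$ are distinct elements of $\mathcal{A}$, then there is no continuous linear surjection of $C_p(S)$ onto $C_p(T)$ and no linear embedding of $C_p(S)$ in $C_p(T)$.
   Context: Subsets of $\omega_1$ carry the subspace topology from the order topology on $\omega_1$. For a space $X$, $C(X)$ is the set of all continuous real-valued functions on $X$. $C_p(X)$ is $C(X)$ with the topology of pointwise convergence, and $C_k(X)$ is $C(X)$ with the compact-open topology. An embedding is a homeomorphism onto a subspace; a linear embedding is an embedding that is a linear map. *)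

theory Defs
  imports "HOL-Analysis.Analysis"
begin

unbundle cardinal_syntax

section \<open>The ordinal $\omega_1$ with its order topology\<close>

text \<open>
  \<^term>\<open>cardSuc natLeq\<close> is the library's successor cardinal of $\aleph_0$: a well-order of
  type $\omega_1$. The lemmas after the instantiations check that the type built from its
  field is an uncountable well-order all of whose proper initial segments are countable.
\<close>

lemma Field_cardSuc_natLeq_ne: "Field (cardSuc natLeq) \<noteq> {}"
  using cardSuc_finite[OF natLeq_Card_order] by (metis Field_natLeq finite.emptyI infinite_UNIV_nat)

typedef omega1 = "Field (cardSuc natLeq)"
  using Field_cardSuc_natLeq_ne by blast

lemma cardSuc_natLeq_Card_order: "Card_order (cardSuc natLeq)"
  by (rule cardSuc_Card_order[OF natLeq_Card_order])

lemma cardSuc_natLeq_Well_order: "Well_order (cardSuc natLeq)"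
  using cardSuc_natLeq_Card_order card_order_on_well_order_on by blast

instantiation omega1 :: linorder
begin

definition less_eq_omega1 :: "omega1 \<Rightarrow> omega1 \<Rightarrow> bool" where
  "x \<le> y \<longleftrightarrow> (Rep_omega1 x, Rep_omega1 y) \<in> cardSuc natLeq"

definition less_omega1 :: "omega1 \<Rightarrow> omega1 \<Rightarrow> bool" where
  "x < y \<longleftrightarrow> x \<le> y \<and> \<not> y \<le> (x::omega1)"

instance
proof
  have lin: "Linear_order (cardSuc natLeq)"
    using cardSuc_natLeq_Well_order by (simp add: well_order_on_def)
  fix x y z :: omega1
  show "x < y \<longleftrightarrow> x \<le> y \<and> \<not> y \<le> x"
    by (rule less_omega1_def)
  show "x \<le> x"
    using lin Rep_omega1[of x] by (auto simp: less_eq_omega1_def order_on_defs refl_on_def)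
  show "x \<le> z" if "x \<le> y" "y \<le> z"
    using lin that unfolding less_eq_omega1_def order_on_defs trans_def by blast
  show "x = y" if "x \<le> y" "y \<le> x"
    using lin that unfolding less_eq_omega1_def order_on_defs antisym_def
    by (metis Rep_omega1_inject)
  show "x \<le> y \<or> y \<le> x"
    using lin Rep_omega1[of x] Rep_omega1[of y]
    unfolding less_eq_omega1_def order_on_defs total_on_def refl_on_def by metis
qed

end

lemma less_omega1_iff:
  "x < y \<longleftrightarrow> (Rep_omega1 x, Rep_omega1 y) \<in> cardSuc natLeq - Id" for x y :: omega1
  by (auto simp: less_le less_eq_omega1_def Rep_omega1_inject)

instance omega1 :: wellorder
proof
  fix P :: "omega1 \<Rightarrow> bool" and a
  assume step: "\<And>x. (\<And>y. y < x \<Longrightarrow> P y) \<Longrightarrow> P x"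
  have "wf (cardSuc natLeq - Id)"
    using cardSuc_natLeq_Well_order by (simp add: well_order_on_def)
  then have "wf (inv_image (cardSuc natLeq - Id) Rep_omega1)"
    by (rule wf_inv_image)
  then show "P a"
    by (induction a rule: wf_induct_rule) (rule step, simp add: less_omega1_iff)
qed

instantiation omega1 :: linorder_topology
begin

definition open_omega1 :: "omega1 set \<Rightarrow> bool" where
  "open_omega1 = generate_topology (range (\<lambda>a. {..<a}) \<union> range (\<lambda>a. {a<..}))"

instance
  by standard (rule open_omega1_def)

end

lemma range_Rep_omega1: "range Rep_omega1 = Field (cardSuc natLeq)"
  using type_definition.Rep_range[OF type_definition_omega1] .

lemma card_of_omega1: "|UNIV :: omega1 set| =o cardSuc natLeq"
proof -
  have "bij_betw Rep_omega1 UNIV (Field (cardSuc natLeq))"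
    by (simp add: bij_betw_def inj_def Rep_omega1_inject range_Rep_omega1)
  then have "|UNIV :: omega1 set| =o |Field (cardSuc natLeq)|"
    using card_of_ordIso by blast
  then show ?thesis
    using card_of_Field_ordIso[OF cardSuc_natLeq_Card_order] ordIso_transitive by blast
qed

lemma countable_iff_ordLeq_natLeq: "countable A \<longleftrightarrow> |A| \<le>o natLeq"
  using card_of_nat ordIso_symmetric ordLeq_ordIso_trans card_of_ordLeq[of A "UNIV :: nat set"]
  unfolding countable_def by blast

lemma uncountable_omega1: "uncountable (UNIV :: omega1 set)"
proof
  assume "countable (UNIV :: omega1 set)"
  then have "cardSuc natLeq \<le>o natLeq"
    using card_of_omega1 countable_iff_ordLeq_natLeq ordIso_ordLeq_trans ordIso_symmetric by blast
  then show False
    using cardSuc_greater[OF natLeq_Card_order] not_ordLess_ordLeq by blast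
qed

lemma countable_lessThan_omega1: "countable {..<a}" for a :: omega1
proof -
  have "|underS (cardSuc natLeq) (Rep_omega1 a)| <o cardSuc natLeq"
    using card_of_underS[OF cardSuc_natLeq_Card_order Rep_omega1] .
  then have "|underS (cardSuc natLeq) (Rep_omega1 a)| \<le>o natLeq"
    using cardSuc_ordLeq_ordLess[OF natLeq_Card_order card_of_Card_order] by blast
  then have "countable (underS (cardSuc natLeq) (Rep_omega1 a))"
    by (simp add: countable_iff_ordLeq_natLeq)
  moreover have "Rep_omega1 ` {..<a} \<subseteq> underS (cardSuc natLeq) (Rep_omega1 a)"
    by (auto simp: underS_def less_omega1_iff)
  ultimately have "countable (Rep_omega1 ` {..<a})"
    using countable_subset by blast
  then show ?thesis
    by (rule countable_image_inj_on) (simp add: inj_on_def Rep_omega1_inject)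
qed


section \<open>Function spaces\<close>

text \<open>
  A real-valued function on the space \<open>X\<close> is represented by its extension to the whole type
  with value \<^term>\<open>undefined\<close> outside \<^term>\<open>topspace X\<close>, as in \<^const>\<open>product_topology\<close>,
  so that equality in \<open>C_fun X\<close> is equality of functions on the space.
\<close>

definition C_fun :: "'a topology \<Rightarrow> ('a \<Rightarrow> real) set" where
  "C_fun X = {f \<in> extensional (topspace X). continuous_map X euclideanreal f}"

definition C_p :: "'a topology \<Rightarrow> ('a \<Rightarrow> real) topology" where
  "C_p X = subtopology (product_topology (\<lambda>_. euclideanreal) (topspace X)) (C_fun X)"

definition C_k :: "'a topology \<Rightarrow> ('a \<Rightarrow> real) topology" where
  "C_k X = topology_generated_by
     {{f \<in> C_fun X. f ` K \<subseteq> U} | K U. compactin X K \<and> openin euclideanreal U}"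

lemma topspace_C_p: "topspace (C_p X) = C_fun X"
  by (auto simp: C_p_def C_fun_def PiE_def)

lemma topspace_C_k: "topspace (C_k X) = C_fun X"
proof -
  have "\<exists>K U. compactin X K \<and> openin euclideanreal U \<and> C_fun X = {f \<in> C_fun X. f ` K \<subseteq> U}"
    by (intro exI[of _ "{}"]) auto
  then show ?thesis
    unfolding C_k_def topology_generated_by_topspace by blast
qed

text \<open>Linearity for the pointwise vector space operations on \<open>C_fun X\<close> and \<open>C_fun Y\<close>.\<close>

definition linear_C :: "'a topology \<Rightarrow> 'b topology \<Rightarrow> (('a \<Rightarrow> real) \<Rightarrow> ('b \<Rightarrow> real)) \<Rightarrow> bool" where
  "linear_C X Y \<phi> \<longleftrightarrow>
     (\<forall>f\<in>C_fun X. \<forall>g\<in>C_fun X.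
        \<phi> (\<lambda>x\<in>topspace X. f x + g x) = (\<lambda>y\<in>topspace Y. \<phi> f y + \<phi> g y)) \<and>
     (\<forall>c. \<forall>f\<in>C_fun X. \<phi> (\<lambda>x\<in>topspace X. c * f x) = (\<lambda>y\<in>topspace Y. c * \<phi> f y))"

end

(* An Ulam matrix gives omega_1 disjoint stationary sets, and suitable unions of them form a family of
   2^omega_1 sets any two of which have stationary differences in both directions. Suppose S - T and
   T - S are stationary. A continuous map between the function spaces, or the inverse of an
   embedding, attaches to each s in S a compact F(s) in T (finite for C_p) that controls the value
   at s. Pressing down on S - T and then closing off at a point delta of T - S gives an increasing
   sequence s_n in S with limit delta such that all F(s_n) lie in one compact subset of T. Functions
   on T are bounded there, but, as delta is missing from S, every real sequence is interpolated at
   the s_n by a continuous function on S. *)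
theory Submission
  imports Defs
begin

section \<open>Stationary subsets of \<open>\<omega>\<^sub>1\<close>\<close>

text \<open>The point \<delta> has two jobs: it lies in T, so that it can complete the union of the
  sets \<open>F (s n)\<close> to a compact one, and outside S, so that functions on S are free near
  it. The obstacle is that \<open>F s\<close> is an arbitrary compact subset of T whose part below s
  varies with s. A point s outside T is missed by \<open>F s\<close>, which leaves a gap below s,
  and the start of this gap is a regressive datum. The two topologies use the common compact set K
  differently. In C_p smallness on K need not be an open condition, so only boundedness on K is
  available; linearity turns control near zero into a bound for all functions. In C_k smallness on K
  is open, and the map, used in the other direction, yields a compact L in S. Below \<delta> this L
  is bounded away from \<delta>, so a function can vanish on L and still be large at some
  \<open>s n\<close>; no linearity enters.\<close>

lemma countable_atMost_omega1: "countable {..a}" for a :: omega1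
proof -
  have "{..a} = insert a {..<a}" by auto
  then show ?thesis using countable_lessThan_omega1 by simp
qed

text \<open>The regularity of omega_1 in the form used throughout: countably many countable initial
  segments cannot cover an uncountable order.\<close>

lemma countable_strict_ub:
  fixes A :: "omega1 set"
  assumes "countable A"
  shows "\<exists>b. \<forall>a\<in>A. a < b"
proof (rule ccontr)
  assume "\<not> ?thesis"
  then have "\<And>b. \<exists>a\<in>A. b \<le> a" by (meson not_less)
  then have "UNIV = (\<Union>a\<in>A. {..a})" by auto
  moreover have "countable (\<Union>a\<in>A. {..a})"
    using assms countable_atMost_omega1 by auto
  ultimately show False using uncountable_omega1 by simp
qed

lemma uncountable_unbounded:
  fixes A :: "omega1 set"
  assumes "uncountable A"
  shows "\<exists>a\<in>A. b < a"
proof (rule ccontr)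
  assume "\<not> ?thesis"
  then have "A \<subseteq> {..b}" by (auto simp: not_less)
  then show False using assms countable_atMost_omega1 countable_subset by blast
qed

lemma gt_ex_omega1: "\<exists>b. a < b" for a :: omega1
  using countable_strict_ub[of "{a}"] by auto

text \<open>The sets of closure points of functions generate the club filter, so this is
  stationarity in the usual sense.\<close>

definition stat :: "omega1 set \<Rightarrow> bool" where
  "stat E \<longleftrightarrow> (\<forall>c :: omega1 \<Rightarrow> omega1. \<exists>\<delta>\<in>E. (\<exists>\<alpha>. \<alpha> < \<delta>) \<and> (\<forall>\<alpha><\<delta>. c \<alpha> < \<delta>))"

text \<open>Countable completeness of the club filter: the values of countably many functions at a
  point have a common strict bound, so one function dominates them all. The witness \<alpha> records
  that \<delta> is not the least element, which is closed vacuously.\<close>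

lemma statD_family:
  fixes c :: "'i \<Rightarrow> omega1 \<Rightarrow> omega1"
  assumes "stat E" and "countable I"
  obtains \<delta> \<alpha> where "\<delta> \<in> E" "\<alpha> < \<delta>" "\<And>i \<beta>. i \<in> I \<Longrightarrow> \<beta> < \<delta> \<Longrightarrow> c i \<beta> < \<delta>"
proof -
  have "\<forall>\<beta>. \<exists>b. \<forall>i\<in>I. c i \<beta> < b"
  proof
    fix \<beta>
    show "\<exists>b. \<forall>i\<in>I. c i \<beta> < b"
      using countable_strict_ub[of "(\<lambda>i. c i \<beta>) ` I"] assms(2) by auto
  qed
  then obtain d where d: "\<And>\<beta> i. i \<in> I \<Longrightarrow> c i \<beta> < d \<beta>" by metis
  obtain \<delta> \<alpha> where "\<delta> \<in> E" "\<alpha> < \<delta>" and "\<forall>\<beta><\<delta>. d \<beta> < \<delta>"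
    using assms(1) unfolding stat_def by blast
  then show thesis
    by (intro that) (auto intro: order.strict_trans[OF d])
qed

lemma stat_mono: "stat A \<Longrightarrow> A \<subseteq> B \<Longrightarrow> stat B"
  unfolding stat_def by blast

text \<open>Iterating a function that majorises \<open>c\<close> on initial segments, starting from
  \<xi>, gives an increasing sequence whose supremum is closed under \<open>c\<close>.\<close>

lemma stat_greaterThan: "stat {\<xi><..}"
  unfolding stat_def
proof
  fix c :: "omega1 \<Rightarrow> omega1"
  have "\<forall>\<beta>. \<exists>b. \<beta> < b \<and> (\<forall>\<gamma>\<le>\<beta>. c \<gamma> < b)"
  proof
    fix \<beta>
    have "countable (insert \<beta> (c ` {..\<beta>}))"
      using countable_atMost_omega1 by auto
    from countable_strict_ub[OF this]
    show "\<exists>b. \<beta> < b \<and> (\<forall>\<gamma>\<le>\<beta>. c \<gamma> < b)" by auto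
  qed
  then obtain d where d: "\<And>\<beta>. \<beta> < d \<beta>" "\<And>\<beta> \<gamma>. \<gamma> \<le> \<beta> \<Longrightarrow> c \<gamma> < d \<beta>" by metis
  define b where "b n = (d ^^ n) \<xi>" for n
  have b: "b 0 = \<xi>" "\<And>n. b (Suc n) = d (b n)" by (auto simp: b_def)
  obtain u where u: "\<And>n. b n < u"
    using countable_strict_ub[of "range b"] by auto
  \<comment> \<open>As \<open>b\<close> is strictly increasing, its least strict upper bound is its
    supremum.\<close>
  define \<delta> where "\<delta> = (LEAST u. \<forall>n. b n < u)"
  have \<delta>: "b n < \<delta>" for n
    unfolding \<delta>_def by (rule LeastI2[of _ u]) (use u in auto)
  have lub: "\<exists>n. \<alpha> \<le> b n" if "\<alpha> < \<delta>" for \<alpha>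
    using not_less_Least[OF that[unfolded \<delta>_def]] by (auto simp: not_less)
  show "\<exists>\<delta>\<in>{\<xi><..}. (\<exists>\<alpha>. \<alpha> < \<delta>) \<and> (\<forall>\<alpha><\<delta>. c \<alpha> < \<delta>)"
  proof (intro bexI[of _ \<delta>] exI[of _ \<xi>] conjI allI impI)
    show "\<xi> < \<delta>" "\<delta> \<in> {\<xi><..}" using \<delta>[of 0] b by auto
    fix \<alpha> assume "\<alpha> < \<delta>"
    then obtain n where "\<alpha> \<le> b n" using lub by blast
    then show "c \<alpha> < \<delta>" using d(2) \<delta>[of "Suc n"] b by (metis order.strict_trans)
  qed
qed

text \<open>If every \<open>A n\<close> had a function witnessing that it is not stationary, a
  common closure point of these functions in the union would contradict one of them.\<close>

lemma stat_UN:
  fixes A :: "nat \<Rightarrow> omega1 set"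
  assumes "stat (\<Union>n. A n)"
  shows "\<exists>n. stat (A n)"
proof (rule ccontr)
  assume "\<not> ?thesis"
  then have "\<forall>n. \<exists>c. \<forall>\<delta>\<in>A n. (\<exists>\<alpha>. \<alpha> < \<delta>) \<longrightarrow> \<not> (\<forall>\<alpha><\<delta>. c \<alpha> < \<delta>)"
    unfolding stat_def by blast
  then obtain c where c: "\<And>n \<delta>. \<delta> \<in> A n \<Longrightarrow> (\<exists>\<alpha>. \<alpha> < \<delta>) \<Longrightarrow> \<not> (\<forall>\<alpha><\<delta>. c n \<alpha> < \<delta>)"
    by metis
  obtain \<delta> \<alpha> where "\<delta> \<in> (\<Union>n. A n)" "\<alpha> < \<delta>" "\<And>n \<beta>. n \<in> UNIV \<Longrightarrow> \<beta> < \<delta> \<Longrightarrow> c n \<beta> < \<delta>"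
    using statD_family[OF assms, of UNIV c] by auto
  then show False using c by blast
qed

text \<open>Fodor's lemma for a relation with an additional integer label. If each pair of \<gamma>
  and k had only countably many s, these would have a bound \<open>b k \<gamma>\<close>; a point s
  of E closed under all \<open>b k\<close> would lie below a bound that is itself below s.\<close>

lemma stat_pressing_down:
  fixes E :: "omega1 set" and P :: "omega1 \<Rightarrow> omega1 \<Rightarrow> nat \<Rightarrow> bool"
  assumes "stat E" and P: "\<And>s \<alpha>. s \<in> E \<Longrightarrow> \<alpha> < s \<Longrightarrow> \<exists>\<gamma><s. \<exists>k. P s \<gamma> k"
  shows "\<exists>\<gamma> k. uncountable {s \<in> E. P s \<gamma> k}"
proof (rule ccontr)
  assume "\<not> ?thesis"
  then have "\<forall>k \<gamma>. \<exists>b. \<forall>s\<in>{s \<in> E. P s \<gamma> k}. s < b"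
    using countable_strict_ub by blast
  then obtain b where b: "\<And>k \<gamma> s. s \<in> E \<Longrightarrow> P s \<gamma> k \<Longrightarrow> s < b k \<gamma>"
    by (metis (mono_tags, lifting) mem_Collect_eq)
  obtain s \<alpha> where s: "s \<in> E" "\<alpha> < s" "\<And>k \<gamma>. k \<in> UNIV \<Longrightarrow> \<gamma> < s \<Longrightarrow> b k \<gamma> < s"
    using statD_family[OF assms(1), of UNIV b] by auto
  then show False using P[OF s(1,2)] b by (metis UNIV_I less_asym)
qed

text \<open>An Ulam matrix.\<close>

lemma disjoint_stationary_family:
  obtains X :: "omega1 set" and Z :: "omega1 \<Rightarrow> omega1 set"
  where "uncountable X" "\<forall>\<xi>\<in>X. stat (Z \<xi>)" "disjoint_family_on Z X"
proof -
  define e where "e \<alpha> = to_nat_on {..<\<alpha>}" for \<alpha> :: omega1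
  have e: "inj_on (e \<alpha>) {..<\<alpha>}" for \<alpha>
    unfolding e_def using inj_on_to_nat_on countable_lessThan_omega1 by blast
  \<comment> \<open>For fixed \<xi> the sets \<open>A n \<xi>\<close> exhaust
    \<open>{\<xi><..}\<close>, so one of them is stationary. For fixed n they are disjoint, because
    \<open>e \<alpha>\<close> is injective; it remains to find one n that serves uncountably many
    \<xi>.\<close>
  define A where "A n \<xi> = {\<alpha>. \<xi> < \<alpha> \<and> e \<alpha> \<xi> = n}" for n \<xi>
  have "\<exists>n. stat (A n \<xi>)" for \<xi>
  proof (rule stat_UN)
    have "(\<Union>n. A n \<xi>) = {\<xi><..}" by (auto simp: A_def)
    then show "stat (\<Union>n. A n \<xi>)" using stat_greaterThan by simp
  qed
  then obtain N where N: "\<And>\<xi>. stat (A (N \<xi>) \<xi>)" by metis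
  have "\<exists>n. uncountable {\<xi>. N \<xi> = n}"
  proof (rule ccontr)
    assume "\<not> ?thesis"
    then have "countable (\<Union>n. {\<xi>. N \<xi> = n})" by (intro countable_UN) auto
    moreover have "(\<Union>n. {\<xi>. N \<xi> = n}) = UNIV" by auto
    ultimately show False using uncountable_omega1 by simp
  qed
  then obtain n where n: "uncountable {\<xi>. N \<xi> = n}" ..
  show thesis
  proof
    show "uncountable {\<xi>. N \<xi> = n}" by (fact n)
    show "\<forall>\<xi>\<in>{\<xi>. N \<xi> = n}. stat (A n \<xi>)" using N by auto
    show "disjoint_family_on (A n) {\<xi>. N \<xi> = n}"
      using e by (auto simp: disjoint_family_on_def A_def inj_on_def)
  qed
qed

text \<open>Unions over plain index sets would be comparable whenever the index sets are. Each index
  i therefore gets two of the disjoint stationary sets, and B selects one of them.\<close>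

lemma stationary_antichain:
  obtains \<A> :: "omega1 set set"
  where "|\<A>| =o ctwo ^c |UNIV :: omega1 set|"
    "\<forall>S\<in>\<A>. \<forall>T\<in>\<A>. S \<noteq> T \<longrightarrow> stat (S - T)"
proof -
  obtain X :: "omega1 set" and Z where X: "uncountable X" "\<forall>\<xi>\<in>X. stat (Z \<xi>)" "disjoint_family_on Z X"
    by (rule disjoint_stationary_family)
  have inf: "infinite (UNIV :: omega1 set)"
    using uncountable_omega1 countable_finite by blast
  have "natLeq <o |X|"
    using X(1) countable_iff_ordLeq_natLeq[of X]
    by (meson card_of_Well_order natLeq_Well_order not_ordLeq_iff_ordLess)
  then have "cardSuc natLeq \<le>o |X|"
    using cardSuc_ordLess_ordLeq[OF natLeq_Card_order card_of_Card_order] by blast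
  then have 1: "|UNIV :: omega1 set| \<le>o |X|"
    using card_of_omega1 ordIso_ordLeq_trans by blast
  have "|(UNIV :: omega1 set) \<times> (UNIV :: bool set)| =o |UNIV :: omega1 set|"
  proof (rule card_of_Times_infinite[OF inf, THEN conjunct1])
    show "|UNIV :: bool set| \<le>o |UNIV :: omega1 set|"
      using inf by (intro ordLess_imp_ordLeq[OF finite_ordLess_infinite])
        (auto simp: Field_card_of card_of_well_order_on)
  qed auto
  then have "|(UNIV :: omega1 set) \<times> (UNIV :: bool set)| \<le>o |X|"
    using 1 ordIso_ordLeq_trans by blast
  then obtain j :: "omega1 \<times> bool \<Rightarrow> omega1" where j: "inj j" "range j \<subseteq> X"
    using card_of_ordLeq[of "(UNIV :: omega1 set) \<times> (UNIV :: bool set)" X] by auto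
  \<comment> \<open>If i separates B from C, the set chosen by B at i is disjoint from everything
    chosen by C, so it lies in the difference.\<close>
  define U where "U B = (\<Union>i. Z (j (i, i \<in> B)))" for B
  have U: "stat (U B - U C)" if "B \<noteq> C" for B C
  proof -
    obtain i where i: "i \<in> B \<longleftrightarrow> i \<notin> C" using \<open>B \<noteq> C\<close> by blast
    have "Z (j (i, i \<in> B)) \<inter> Z (j (k, k \<in> C)) = {}" for k
      using i j by (intro disjoint_family_onD[OF X(3)]) (auto dest: injD)
    then have "Z (j (i, i \<in> B)) \<subseteq> U B - U C" unfolding U_def by blast
    then show ?thesis using X(2) j stat_mono by blast
  qed
  have "inj U"
  proof (rule injI, rule ccontr)
    fix B C assume "U B = U C" "B \<noteq> C"
    then have "stat {}" using U[of B C] by simp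
    then show False unfolding stat_def by simp
  qed
  then have "|range U| =o |UNIV :: omega1 set set|"
    by (metis card_of_ordIsoI inj_on_imp_bij_betw ordIso_symmetric)
  also have "|UNIV :: omega1 set set| =o ctwo ^c |UNIV :: omega1 set|"
    using card_of_Pow_Func[of "UNIV :: omega1 set"] by (simp add: ctwo_def cexp_def Field_card_of)
  finally (ordIso_transitive) have "|range U| =o ctwo ^c |UNIV :: omega1 set|" .
  moreover have "\<forall>S\<in>range U. \<forall>T\<in>range U. S \<noteq> T \<longrightarrow> stat (S - T)"
    by (metis U imageE)
  ultimately show thesis by (rule that)
qed

section \<open>Compact sets with stationary differences\<close>

text \<open>Every point has a successor, so a closed initial segment is also an open one.\<close>

lemma open_atMost_omega1: "open {..a}" for a :: omega1
proof -
  have "{..a} = {..<LEAST b. a < b}"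
    using LeastI_ex[OF gt_ex_omega1[of a]] not_less_Least[of _ "\<lambda>b. a < b"]
    by (auto simp: not_less[symmetric] dest: le_less_trans)
  then show ?thesis by simp
qed

text \<open>K plays the limit of a convergent sequence of compact sets: a finite subcover of K
  already contains all but finitely many \<open>C n\<close>.\<close>

lemma compact_UN_converging:
  fixes C :: "nat \<Rightarrow> 'a::topological_space set"
  assumes "compact K" "\<And>n. compact (C n)"
    and ev: "\<And>V. open V \<Longrightarrow> K \<subseteq> V \<Longrightarrow> \<exists>N. \<forall>n\<ge>N. C n \<subseteq> V"
  shows "compact (K \<union> (\<Union>n. C n))"
proof (rule compactI)
  fix \<C> :: "'a set set" assume \<C>: "\<forall>t\<in>\<C>. open t" "K \<union> (\<Union>n. C n) \<subseteq> \<Union>\<C>"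
  obtain \<D> where \<D>: "\<D> \<subseteq> \<C>" "finite \<D>" "K \<subseteq> \<Union>\<D>"
    using compactE[OF assms(1), of \<C>] \<C> by (metis le_supE)
  obtain N where N: "\<forall>n\<ge>N. C n \<subseteq> \<Union>\<D>"
    using ev[of "\<Union>\<D>"] \<D> \<C> by (meson open_Union subsetD)
  have "compact (\<Union>n<N. C n)" using assms(2) by (intro compact_UN) auto
  then obtain \<E> where \<E>: "\<E> \<subseteq> \<C>" "finite \<E>" "(\<Union>n<N. C n) \<subseteq> \<Union>\<E>"
    using compactE[of "\<Union>n<N. C n" \<C>] \<C> by (metis (no_types, lifting) SUP_le_iff UNIV_I le_supE)
  show "\<exists>C'\<subseteq>\<C>. finite C' \<and> K \<union> (\<Union>n. C n) \<subseteq> \<Union>C'"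
  proof (intro exI conjI)
    show "\<D> \<union> \<E> \<subseteq> \<C>" "finite (\<D> \<union> \<E>)" using \<D> \<E> by auto
    have "C n \<subseteq> \<Union>(\<D> \<union> \<E>)" for n
    proof (cases "n < N")
      case True
      then show ?thesis using \<E>(3) by blast
    next
      case False
      then have "C n \<subseteq> \<Union>\<D>" using N by simp
      then show ?thesis by blast
    qed
    then show "K \<union> (\<Union>n. C n) \<subseteq> \<Union>(\<D> \<union> \<E>)" using \<D> by blast
  qed
qed

text \<open>Only countably many intervals have their endpoints in \<open>{..\<gamma>}\<close>, and a
  compact set needs only finitely many of them to fit inside a given open set.\<close>

lemma countable_compact_base:
  fixes \<gamma> :: omega1
  obtains \<B> where "countable \<B>" "\<forall>B\<in>\<B>. open B"
    "\<forall>K U. compact K \<and> K \<subseteq> {..\<gamma>} \<and> open U \<and> K \<subseteq> U \<longrightarrow> (\<exists>B\<in>\<B>. K \<subseteq> B \<and> B \<subseteq> U)"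
proof -
  \<comment> \<open>The sets from \<open>atMost\<close> are there for the least element, which no
    half-open interval contains.\<close>
  define I where "I = (\<lambda>(a, b). {a<..b}) ` ({..\<gamma>} \<times> {..\<gamma>}) \<union> atMost ` {..\<gamma>}"
  define \<B> where "\<B> = Union ` {D. D \<subseteq> I \<and> finite D}"
  have "countable I"
    unfolding I_def using countable_atMost_omega1 by (intro countable_Un) auto
  then have cnt: "countable \<B>"
    unfolding \<B>_def using countable_Collect_finite_subset[of I]
    by (simp add: conj_commute)
  have opI: "open D" if "D \<in> I" for D
  proof -
    have "open {a<..b}" for a b :: omega1
      using open_Int[OF open_greaterThan[of a] open_atMost_omega1[of b]]
      by (simp add: greaterThanAtMost_def)
    then show ?thesis using that open_atMost_omega1 by (auto simp: I_def)
  qed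
  then have opB: "\<forall>B\<in>\<B>. open B" by (auto simp: \<B>_def)
  have "\<exists>B\<in>\<B>. K \<subseteq> B \<and> B \<subseteq> U"
    if K: "compact K" "K \<subseteq> {..\<gamma>}" and U: "open U" "K \<subseteq> U" for K U
  proof -
    have "\<exists>D\<in>I. x \<in> D \<and> D \<subseteq> U" if x: "x \<in> K" for x
    proof (cases "\<exists>y. y < x")
      case True
      then obtain b where b: "b < x" "{b<..x} \<subseteq> U"
        using open_left[OF U(1), of x] U x by blast
      then have "b \<le> \<gamma>" "x \<le> \<gamma>" using K x by auto
      then have "{b<..x} \<in> I" by (force simp: I_def)
      then show ?thesis using b by (intro bexI[of _ "{b<..x}"]) auto
    next
      case False
      then have "{..x} = {x}" by (auto simp: not_less intro: antisym)
      then show ?thesis using K U x by (intro bexI[of _ "{..x}"]) (auto simp: I_def)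
    qed
    then have cov: "K \<subseteq> \<Union>{D\<in>I. D \<subseteq> U}" by blast
    have op: "\<forall>D\<in>{D\<in>I. D \<subseteq> U}. open D" using opI by blast
    obtain \<D> where "\<D> \<subseteq> {D\<in>I. D \<subseteq> U}" "finite \<D>" "K \<subseteq> \<Union>\<D>"
      by (rule compactE[OF K(1) cov]) (use op in auto)
    then show ?thesis by (intro bexI[of _ "\<Union>\<D>"]) (auto simp: \<B>_def)
  qed
  then have "\<forall>K U. compact K \<and> K \<subseteq> {..\<gamma>} \<and> open U \<and> K \<subseteq> U \<longrightarrow> (\<exists>B\<in>\<B>. K \<subseteq> B \<and> B \<subseteq> U)"
    by simp
  with cnt opB show thesis by (rule that)
qed

text \<open>The condensation point argument: otherwise each s in E would lie in one of countably
  many countable classes.\<close>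

lemma uncountable_condensation:
  assumes "uncountable E" "countable \<B>"
  shows "\<exists>s\<in>E. \<forall>B\<in>\<B>. C s \<subseteq> B \<longrightarrow> uncountable {s'\<in>E. C s' \<subseteq> B}"
proof (rule ccontr)
  assume "\<not> ?thesis"
  then have "E \<subseteq> (\<Union>B\<in>{B\<in>\<B>. countable {s'\<in>E. C s' \<subseteq> B}}. {s'\<in>E. C s' \<subseteq> B})" by blast
  moreover have "countable (\<Union>B\<in>{B\<in>\<B>. countable {s'\<in>E. C s' \<subseteq> B}}. {s'\<in>E. C s' \<subseteq> B})"
    using assms(2) by (intro countable_UN) auto
  ultimately show False using assms(1) countable_subset by blast
qed

text \<open>A compact set is closed here, so a left neighbourhood of s misses it. Applied to
  \<open>F s\<close> it supplies the regressive datum; applied to a compact subset of S it keeps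
  that set away from \<delta>.\<close>

lemma bounded_below_missing_point:
  fixes s :: omega1
  assumes "compact K" "s \<notin> K" "\<alpha> < s"
  shows "\<exists>\<gamma><s. \<forall>x\<in>K. x < s \<longrightarrow> x \<le> \<gamma>"
proof -
  have "open (- K)" using assms(1) compact_imp_closed by auto
  then obtain b where "b < s" "{b<..s} \<subseteq> - K"
    using open_left[of "- K" s \<alpha>] assms by auto
  then have "x \<le> b" if "x \<in> K" "x < s" for x
    using that by (meson ComplD greaterThanAtMost_iff less_imp_le not_less subsetD)
  then show ?thesis using \<open>b < s\<close> by blast
qed

text \<open>Pressing down on \<open>S - T\<close> makes the gap of \<open>F s\<close> below \<open>s\<close> start at a fixed \<open>\<gamma>\<close>. The part of
  \<open>F s\<close> up to \<open>\<gamma>\<close> can be made to converge to a single compact set \<open>C s0\<close>, since \<open>{..\<gamma>}\<close> is second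
  countable, and the part from \<open>s\<close> on is pushed to \<open>\<delta>\<close>.\<close>

lemma bounded_on_convergent_sequence:
  fixes S T :: "omega1 set" and m :: "omega1 \<Rightarrow> nat"
  assumes ST: "stat (S - T)" and TS: "stat (T - S)"
    and F: "\<And>s. s \<in> S \<Longrightarrow> compact (F s)" "\<And>s. s \<in> S \<Longrightarrow> F s \<subseteq> T"
  obtains s :: "nat \<Rightarrow> omega1" and \<delta> K k where "strict_mono s" "\<forall>n. s n \<in> S" "\<delta> \<notin> S" "\<forall>n. s n < \<delta>"
    "\<forall>a<\<delta>. \<exists>n. a < s n" "compact K" "K \<subseteq> T" "\<forall>n. F (s n) \<subseteq> K" "\<forall>n. m (s n) = k"
proof -
  have "\<exists>\<gamma> k. uncountable {s \<in> S - T. (\<forall>x\<in>F s. x < s \<longrightarrow> x \<le> \<gamma>) \<and> m s = k}"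
  proof (rule stat_pressing_down[OF ST])
    fix s \<alpha> assume "s \<in> S - T" "\<alpha> < s"
    then show "\<exists>\<gamma><s. \<exists>k. (\<forall>x\<in>F s. x < s \<longrightarrow> x \<le> \<gamma>) \<and> m s = k"
      using bounded_below_missing_point[of "F s" s \<alpha>] F[of s] by blast
  qed
  then obtain \<gamma> k where unc: "uncountable {s \<in> S - T. (\<forall>x\<in>F s. x < s \<longrightarrow> x \<le> \<gamma>) \<and> m s = k}"
    by blast
  define E where "E = {s \<in> S - T. (\<forall>x\<in>F s. x < s \<longrightarrow> x \<le> \<gamma>) \<and> m s = k}"
  define C where "C s = F s \<inter> {..\<gamma>}" for s
  obtain \<B> where \<B>: "countable \<B>" "\<forall>B\<in>\<B>. open B"
    and base: "\<forall>K U. compact K \<and> K \<subseteq> {..\<gamma>} \<and> open U \<and> K \<subseteq> U \<longrightarrow> (\<exists>B\<in>\<B>. K \<subseteq> B \<and> B \<subseteq> U)"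
    by (rule countable_compact_base)
  obtain s0 where s0: "s0 \<in> E" "\<And>B. B \<in> \<B> \<Longrightarrow> C s0 \<subseteq> B \<Longrightarrow> uncountable {s\<in>E. C s \<subseteq> B}"
    using uncountable_condensation[OF unc \<B>(1), of C] unfolding E_def by blast
  have C0: "compact (C s0)" "C s0 \<subseteq> {..\<gamma>}"
    using F(1)[of s0] s0 by (auto simp: C_def E_def intro: compact_Int_closed)
  then have base0: "\<exists>B\<in>\<B>. C s0 \<subseteq> B \<and> B \<subseteq> V" if "open V" "C s0 \<subseteq> V" for V
    using base that by blast
  define \<U> where "\<U> = {B\<in>\<B>. C s0 \<subseteq> B}"
  have \<U>: "countable \<U>" "\<U> \<noteq> {}"
    using \<B>(1) base0[of UNIV] by (auto simp: \<U>_def)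
  define U where "U = from_nat_into \<U>"
  have U: "U n \<in> \<U>" for n using \<U> by (simp add: U_def from_nat_into)
  \<comment> \<open>\<open>U\<close> enumerates the basic neighbourhoods of \<open>C s0\<close>.
    Entering the first n + 1 of them at stage n forces convergence, and having uncountably many
    candidates allows s to exceed any \<alpha>.\<close>
  have "\<exists>s\<in>E. C s \<subseteq> (\<Inter>i\<le>n. U i) \<and> \<alpha> < s" for n \<alpha>
  proof -
    have "open (\<Inter>i\<le>n. U i)" using U \<B>(2) by (intro open_INT) (auto simp: \<U>_def)
    moreover have "C s0 \<subseteq> (\<Inter>i\<le>n. U i)" using U by (auto simp: \<U>_def)
    ultimately have "\<exists>B\<in>\<B>. C s0 \<subseteq> B \<and> B \<subseteq> (\<Inter>i\<le>n. U i)" by (rule base0)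
    then obtain B where B: "B \<in> \<B>" "C s0 \<subseteq> B" "B \<subseteq> (\<Inter>i\<le>n. U i)" by auto
    obtain s where "s \<in> {s\<in>E. C s \<subseteq> B}" "\<alpha> < s"
      using uncountable_unbounded[OF s0(2)[OF B(1,2)]] by blast
    then show ?thesis using B(3) by (intro bexI[of _ s]) auto
  qed
  then obtain c where c: "\<And>n \<alpha>. c n \<alpha> \<in> E" "\<And>n \<alpha>. C (c n \<alpha>) \<subseteq> (\<Inter>i\<le>n. U i)" "\<And>n \<alpha>. \<alpha> < c n \<alpha>"
    by metis
  have "\<exists>b. s \<in> S \<longrightarrow> (\<forall>x\<in>F s. x < b)" for s
  proof (cases "s \<in> S \<and> F s \<noteq> {}")
    case True
    then obtain t where "\<forall>x\<in>F s. x \<le> t" using compact_attains_sup[of "F s"] F by blast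
    then show ?thesis using gt_ex_omega1[of t] by (meson le_less_trans)
  qed auto
  then obtain d where d: "\<And>s x. s \<in> S \<Longrightarrow> x \<in> F s \<Longrightarrow> x < d s" by metis
  \<comment> \<open>The index type \<open>nat option\<close> packs \<open>d\<close> and all
    \<open>c n\<close> into one countable family. Closure under the \<open>c n\<close> lets the
    sequence stay below \<delta>; closure under \<open>d\<close> does the same for the sets
    \<open>F (s n)\<close>.\<close>
  obtain \<delta> \<alpha>0 where \<delta>: "\<delta> \<in> T - S" "\<alpha>0 < \<delta>"
    and cl: "\<And>i \<beta>. i \<in> UNIV \<Longrightarrow> \<beta> < \<delta> \<Longrightarrow> case_option d c i \<beta> < \<delta>"
    by (rule statD_family[OF TS, of UNIV "case_option d c"]) auto
  have cl_c: "c n \<beta> < \<delta>" if "\<beta> < \<delta>" for n \<beta> using cl[of "Some n"] that by simp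
  have cl_d: "d \<beta> < \<delta>" if "\<beta> < \<delta>" for \<beta> using cl[of None] that by simp
  define \<alpha> where "\<alpha> = from_nat_into {..<\<delta>}"
  have \<alpha>: "range \<alpha> = {..<\<delta>}"
    unfolding \<alpha>_def using \<delta> countable_lessThan_omega1 by (intro range_from_nat_into) auto
  \<comment> \<open>Taking the maximum with the previous term makes s increasing; taking it with
    \<alpha>, which enumerates all points below \<delta>, makes s cofinal in \<delta>.\<close>
  define s where "s = rec_nat (c 0 (\<alpha> 0)) (\<lambda>n x. c (Suc n) (max x (\<alpha> (Suc n))))"
  have s_0: "s 0 = c 0 (\<alpha> 0)" and s_Suc: "\<And>n. s (Suc n) = c (Suc n) (max (s n) (\<alpha> (Suc n)))"
    by (auto simp: s_def)
  have s_ex: "\<exists>\<beta>. s n = c n \<beta> \<and> \<alpha> n \<le> \<beta>" for n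
    by (cases n) (auto simp: s_0 s_Suc)
  have sE: "s n \<in> E" for n using s_ex c(1) by metis
  then have sS: "s n \<in> S" for n by (auto simp: E_def)
  have s\<delta>: "s n < \<delta>" for n
    using \<alpha> by (induction n) (auto simp: s_0 s_Suc intro!: cl_c)
  have mono: "strict_mono s"
    using c(3) by (intro strict_monoI_Suc) (metis s_Suc max.strict_boundedE)
  have cof: "\<exists>n. a < s n" if "a < \<delta>" for a
  proof -
    have "a \<in> range \<alpha>" using that \<alpha> by simp
    then obtain n where n: "\<alpha> n = a" by blast
    obtain \<beta> where "s n = c n \<beta>" "\<alpha> n \<le> \<beta>" using s_ex by blast
    then show ?thesis using c(3)[of \<beta> n] n by (intro exI[of _ n]) auto
  qed
  have sU: "C (s n) \<subseteq> U i" if "i \<le> n" for i n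
  proof -
    obtain \<beta> where "s n = c n \<beta>" using s_ex by blast
    then show ?thesis using c(2)[of n \<beta>] that by auto
  qed
  have "compact (insert \<delta> (C s0) \<union> (\<Union>n. F (s n)))"
  proof (rule compact_UN_converging)
    show "compact (insert \<delta> (C s0))" using C0 by simp
    show "compact (F (s n))" for n using F(1) sS by blast
    fix V assume V: "open V" "insert \<delta> (C s0) \<subseteq> V"
    then obtain B where B: "B \<in> \<B>" "C s0 \<subseteq> B" "B \<subseteq> V" using base0[of V] by blast
    then obtain i where i: "U i = B"
      using from_nat_into_surj[OF \<U>(1), of B] by (auto simp: \<U>_def U_def)
    obtain a where a: "a < \<delta>" "{a<..\<delta>} \<subseteq> V" using open_left[OF V(1) _ \<delta>(2)] V(2) by blast
    obtain j where j: "a < s j" using cof a by blast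
    show "\<exists>N. \<forall>n\<ge>N. F (s n) \<subseteq> V"
    proof (intro exI allI impI subsetI)
      fix n x assume n: "max i j \<le> n" and x: "x \<in> F (s n)"
      show "x \<in> V"
      proof (cases "x \<le> \<gamma>")
        case True
        then have "x \<in> C (s n)" using x by (simp add: C_def)
        then show ?thesis using sU[of i n] n i B by auto
      next
        case False
        then have "s n \<le> x" using sE[of n] x by (force simp: E_def)
        moreover have "s j \<le> s n" using mono n by (simp add: strict_mono_less_eq)
        moreover have "x < \<delta>" using d[OF sS x] cl_d[OF s\<delta>[of n]] by (rule less_trans)
        ultimately show ?thesis using a j by force
      qed
    qed
  qed
  moreover have "insert \<delta> (C s0) \<union> (\<Union>n. F (s n)) \<subseteq> T"
    using \<delta> F(2) sS s0 by (fastforce simp: C_def E_def)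
  ultimately show thesis
    using that[of s \<delta> "insert \<delta> (C s0) \<union> (\<Union>n. F (s n))" k] mono sS \<delta> s\<delta> cof sE
    by (auto simp: E_def)
qed

text \<open>The value at \<open>\<delta>\<close> is arbitrary; continuity is only claimed off \<open>\<delta>\<close>.\<close>

definition step_fun :: "(nat \<Rightarrow> omega1) \<Rightarrow> omega1 \<Rightarrow> (nat \<Rightarrow> real) \<Rightarrow> omega1 \<Rightarrow> real" where
  "step_fun s \<delta> a x = (if x < \<delta> then a (LEAST n. x \<le> s n) else 0)"

lemma step_fun_eq:
  assumes "strict_mono s" "\<forall>n. s n < \<delta>"
  shows "step_fun s \<delta> a (s n) = a n"
proof -
  have "(LEAST k. s n \<le> s k) = n"
    using assms(1) by (intro Least_equality) (auto simp: strict_mono_less_eq)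
  then show ?thesis using assms(2) by (simp add: step_fun_def)
qed

text \<open>The function is locally constant off \<delta>: the blocks between consecutive
  \<open>s n\<close> are open because closed initial segments are, and they accumulate only at
  \<delta>, which S omits.\<close>

lemma continuous_on_step_fun:
  assumes "strict_mono s" "\<forall>n. s n < \<delta>" "\<forall>a<\<delta>. \<exists>n. a < s n" "\<delta> \<notin> S"
  shows "continuous_on S (step_fun s \<delta> a)"
  unfolding continuous_on_def
proof
  fix x assume "x \<in> S"
  have "\<exists>V. open V \<and> x \<in> V \<and> (\<forall>y\<in>V. step_fun s \<delta> a y = step_fun s \<delta> a x)"
  proof (cases "x < \<delta>")
    case False
    then have "\<delta> < x" using \<open>x \<in> S\<close> assms(4) by (metis not_less_iff_gr_or_eq)
    then show ?thesis by (intro exI[of _ "{\<delta><..}"]) (auto simp: step_fun_def)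
  next
    case True
    define n where "n = (LEAST n. x \<le> s n)"
    have "\<exists>n. x \<le> s n" using assms(3) True less_imp_le by blast
    then have xn: "x \<le> s n" unfolding n_def by (rule LeastI_ex)
    have least: "s m < x" if "m < n" for m
      using not_less_Least[OF that[unfolded n_def]] by simp
    define V where "V = {..s n} \<inter> (\<Inter>m<n. {s m<..})"
    have "open V" unfolding V_def by (intro open_Int open_INT open_atMost_omega1) auto
    moreover have "x \<in> V" using xn least by (auto simp: V_def)
    moreover have "step_fun s \<delta> a y = a n" if "y \<in> V" for y
    proof -
      have "(LEAST k. y \<le> s k) = n"
      proof (rule Least_equality)
        show "n \<le> k" if "y \<le> s k" for k
        proof (rule ccontr)
          assume "\<not> n \<le> k"
          then have "s k < y" using \<open>y \<in> V\<close> by (auto simp: V_def)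
          then show False using that by simp
        qed
      qed (use that in \<open>auto simp: V_def\<close>)
      moreover have "y < \<delta>" using that spec[OF assms(2), of n] by (auto simp: V_def)
      ultimately show ?thesis by (simp add: step_fun_def)
    qed
    ultimately show ?thesis by auto
  qed
  then show "(step_fun s \<delta> a \<longlongrightarrow> step_fun s \<delta> a x) (at x within S)"
    by (intro tendsto_eventually) (auto simp: eventually_at_topological)
qed

section \<open>Function spaces over sets with stationary differences\<close>

lemma C_fun_top_of_set: "f \<in> C_fun (top_of_set S) \<longleftrightarrow> f \<in> extensional S \<and> continuous_on S f"
  by (simp add: C_fun_def)

lemma restrict_C_fun: "continuous_on S f \<Longrightarrow> restrict f S \<in> C_fun (top_of_set S)"
  by (auto simp: C_fun_top_of_set cong: continuous_on_cong)

lemma zero_C_fun: "(\<lambda>x\<in>topspace X. 0) \<in> C_fun X"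
  by (auto simp: C_fun_def intro: continuous_map_eq[of _ _ "\<lambda>_. 0"])

lemma scale_C_fun: "f \<in> C_fun X \<Longrightarrow> (\<lambda>x\<in>topspace X. c * f x) \<in> C_fun X"
  by (auto simp: C_fun_def intro: continuous_map_eq[of _ _ "\<lambda>x. c * f x"] continuous_map_real_mult)

text \<open>Refutes any estimate of \<open>f s\<close> by \<open>M s\<close> times a bound for g on
  \<open>F s\<close>. All \<open>F (s n)\<close> lie in one compact K, so a single R bounds g on
  each of them, while f may grow along the sequence at will.\<close>

lemma function_exceeding_bounds:
  fixes S T :: "omega1 set" and M :: "omega1 \<Rightarrow> real"
  assumes "stat (S - T)" "stat (T - S)"
    and "\<And>s. s \<in> S \<Longrightarrow> compact (F s)" "\<And>s. s \<in> S \<Longrightarrow> F s \<subseteq> T"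
  shows "\<exists>f\<in>C_fun (top_of_set S). \<forall>g\<in>C_fun (top_of_set T).
    \<exists>s\<in>S. \<exists>R>0. (\<forall>x\<in>F s. \<bar>g x\<bar> \<le> R) \<and> M s * R < \<bar>f s\<bar>"
proof -
  obtain s :: "nat \<Rightarrow> omega1" and \<delta> K k where s: "strict_mono s" "\<forall>n. s n \<in> S" "\<delta> \<notin> S" "\<forall>n. s n < \<delta>"
    "\<forall>a<\<delta>. \<exists>n. a < s n" and K: "compact K" "K \<subseteq> T" "\<forall>n. F (s n) \<subseteq> K"
    and "\<forall>n::nat. (0::nat) = k"
    using assms by (rule bounded_on_convergent_sequence[where m = "\<lambda>_. 0"])
  \<comment> \<open>The factor n + 1 eventually beats every R; adding 1 to the modulus of M keeps
    the inequality strict where M vanishes.\<close>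
  define f where "f = step_fun s \<delta> (\<lambda>n. (real n + 1) * (1 + \<bar>M (s n)\<bar>))"
  have "continuous_on S f" unfolding f_def by (rule continuous_on_step_fun[OF s(1,4,5,3)])
  then have "restrict f S \<in> C_fun (top_of_set S)" by (rule restrict_C_fun)
  moreover have "\<exists>s\<in>S. \<exists>R>0. (\<forall>x\<in>F s. \<bar>g x\<bar> \<le> R) \<and> M s * R < \<bar>restrict f S s\<bar>"
    if g: "g \<in> C_fun (top_of_set T)" for g
  proof -
    have "compact (g ` K)"
      using g K by (intro compact_continuous_image) (auto simp: C_fun_top_of_set intro: continuous_on_subset)
    then obtain R where R: "R > 0" "\<forall>x\<in>K. \<bar>g x\<bar> \<le> R"
      using compact_imp_bounded bounded_pos by (metis (no_types, lifting) imageI real_norm_def)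
    obtain n where n: "R \<le> real n" using real_arch_simple by blast
    have "M (s n) * R \<le> \<bar>M (s n)\<bar> * R" using R by (intro mult_right_mono) auto
    also have "\<dots> \<le> \<bar>M (s n)\<bar> * real n" using n by (intro mult_left_mono) auto
    also have "\<dots> < (real n + 1) * (1 + \<bar>M (s n)\<bar>)"
      by (simp add: algebra_simps add_nonneg_pos add_pos_nonneg)
    also have "\<dots> = f (s n)" unfolding f_def by (rule step_fun_eq[OF s(1,4), symmetric])
    finally have "M (s n) * R < \<bar>restrict f S (s n)\<bar>" using s(2) by simp
    then show ?thesis using R K(3) s(2) by blast
  qed
  ultimately show ?thesis by blast
qed

text \<open>K and \<epsilon> are fixed before L. A compact L in S is bounded below \<delta>, so some
  tail of the sequence avoids it, and a step function can be switched on there only.\<close>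

lemma compact_not_controlling:
  fixes S T :: "omega1 set" and e :: "omega1 \<Rightarrow> real"
  assumes "stat (S - T)" "stat (T - S)"
    and "\<And>s. s \<in> S \<Longrightarrow> compact (F s)" "\<And>s. s \<in> S \<Longrightarrow> F s \<subseteq> T"
    and e: "\<And>s. s \<in> S \<Longrightarrow> e s > 0"
  obtains K \<epsilon> where "compact K" "K \<subseteq> T" "\<epsilon> > 0"
    "\<forall>L. compact L \<and> L \<subseteq> S \<longrightarrow> (\<exists>(h :: omega1 \<Rightarrow> real) s. continuous_on S h \<and>
       (\<forall>x\<in>L. h x = 0) \<and> s \<in> S \<and> h s = 2 \<and> F s \<subseteq> K \<and> \<epsilon> \<le> e s)"
proof -
  obtain s :: "nat \<Rightarrow> omega1" and \<delta> K k where s: "strict_mono s" "\<forall>n. s n \<in> S" "\<delta> \<notin> S" "\<forall>n. s n < \<delta>"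
    "\<forall>a<\<delta>. \<exists>n. a < s n" and K: "compact K" "K \<subseteq> T" "\<forall>n. F (s n) \<subseteq> K"
    and k: "\<forall>n. nat \<lceil>1 / e (s n)\<rceil> = k"
    \<comment> \<open>Freezing the integer \<open>nat \<lceil>1 / e s\<rceil>\<close> bounds
      \<open>e\<close> away from zero along the sequence.\<close>
    using assms(1-4) by (rule bounded_on_convergent_sequence[where m = "\<lambda>s. nat \<lceil>1 / e s\<rceil>"])
  have le: "1 / (real k + 1) \<le> e (s n)" for n
  proof -
    have "1 / e (s n) \<le> real k + 1" using spec[OF k, of n] real_nat_ceiling_ge[of "1 / e (s n)"] by linarith
    then show ?thesis using e[of "s n"] s(2) by (simp add: field_simps)
  qed
  have "\<exists>(h :: omega1 \<Rightarrow> real) s. continuous_on S h \<and> (\<forall>x\<in>L. h x = 0) \<and>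
       s \<in> S \<and> h s = 2 \<and> F s \<subseteq> K \<and> 1 / (real k + 1) \<le> e s" if L: "compact L" "L \<subseteq> S" for L
  proof -
    obtain \<gamma> where \<gamma>: "\<gamma> < \<delta>" "\<forall>x\<in>L. x < \<delta> \<longrightarrow> x \<le> \<gamma>"
      using bounded_below_missing_point[OF L(1), of \<delta> "s 0"] L s by blast
    obtain N where N: "\<gamma> < s N" using s(5) \<gamma> by blast
    \<comment> \<open>Points of L below \<delta> are at most \<open>s N\<close> and get the value 0;
      those above \<delta> get the default 0. The value 2 is chosen to exceed the tolerance 1 in the
      applications.\<close>
    define h where "h = step_fun s \<delta> (\<lambda>n. if n \<le> N then 0 else 2)"
    have "h x = 0" if "x \<in> L" for x
    proof (cases "x < \<delta>")
      case True
      then have "x \<le> s N" using \<gamma> N that by force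
      then have "(LEAST n. x \<le> s n) \<le> N" by (rule Least_le)
      then show ?thesis by (simp add: h_def step_fun_def)
    qed (simp add: h_def step_fun_def)
    moreover have "continuous_on S h" unfolding h_def by (rule continuous_on_step_fun[OF s(1,4,5,3)])
    moreover have "h (s (Suc N)) = 2" unfolding h_def by (subst step_fun_eq[OF s(1,4)]) simp
    ultimately show ?thesis using le K(3) s(2) by blast
  qed
  then show thesis using K by (intro that[of K "1 / (real k + 1)"]) auto
qed

section \<open>Basic neighbourhoods in C_k and C_p\<close>

text \<open>One half of the agreement of the compact-open topology with uniform convergence on
  compact sets. For a subbasic set, the compact image of K has a positive margin inside U.\<close>

lemma C_k_nbhd:
  assumes "openin (C_k X) W" "f \<in> W"
  obtains K \<epsilon> where "compactin X K" "\<epsilon> > 0" "\<forall>g\<in>C_fun X. (\<forall>x\<in>K. \<bar>g x - f x\<bar> < \<epsilon>) \<longrightarrow> g \<in> W"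
proof -
  have fX: "f \<in> C_fun X" using assms openin_subset topspace_C_k by blast
  have "generate_topology_on {{f \<in> C_fun X. f ` K \<subseteq> U} | K U. compactin X K \<and> openin euclideanreal U} W"
    using assms(1) by (simp add: C_k_def openin_topology_generated_by_iff)
  then have "\<exists>K \<epsilon>. compactin X K \<and> \<epsilon> > 0 \<and>
      (\<forall>g\<in>C_fun X. (\<forall>x\<in>K. \<bar>g x - f x\<bar> < \<epsilon>) \<longrightarrow> g \<in> W)"
    using assms(2)
  proof induction
    case Empty
    then show ?case by simp
  next
    case (Int A B)
    have f: "f \<in> A" "f \<in> B" using Int.prems by auto
    obtain K1 e1 where 1: "compactin X K1" "e1 > 0"
        "\<forall>g\<in>C_fun X. (\<forall>x\<in>K1. \<bar>g x - f x\<bar> < e1) \<longrightarrow> g \<in> A"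
      using Int.IH(1)[OF f(1)] by (elim exE conjE)
    obtain K2 e2 where 2: "compactin X K2" "e2 > 0"
        "\<forall>g\<in>C_fun X. (\<forall>x\<in>K2. \<bar>g x - f x\<bar> < e2) \<longrightarrow> g \<in> B"
      using Int.IH(2)[OF f(2)] by (elim exE conjE)
    show ?case
      by (rule exI[of _ "K1 \<union> K2"], rule exI[of _ "min e1 e2"])
        (use 1 2 in \<open>auto intro: compactin_Un\<close>)
  next
    case (UN \<K>)
    obtain A where A: "A \<in> \<K>" "f \<in> A" using UN.prems by blast
    obtain K \<epsilon> where "compactin X K" "\<epsilon> > 0"
        "\<forall>g\<in>C_fun X. (\<forall>x\<in>K. \<bar>g x - f x\<bar> < \<epsilon>) \<longrightarrow> g \<in> A"
      using UN.IH[OF A] by (elim exE conjE)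
    then show ?case using A(1) by (intro exI[of _ K] exI[of _ \<epsilon>]) auto
  next
    case (Basis A)
    then obtain K U where A: "A = {f \<in> C_fun X. f ` K \<subseteq> U}" "compactin X K" "open U"
      by auto
    have "f ` K \<subseteq> U" using A(1) Basis.prems by blast
    moreover have "compact (f ` K)"
      using image_compactin[OF A(2), of euclideanreal f] fX by (simp add: C_fun_def)
    ultimately obtain \<epsilon> where \<epsilon>: "\<epsilon> > 0" "(\<Union>y\<in>f ` K. ball y \<epsilon>) \<subseteq> U"
      using compact_subset_open_imp_ball_epsilon_subset[of "f ` K" U] A(3) by metis
    have "g \<in> A" if g: "g \<in> C_fun X" "\<forall>x\<in>K. \<bar>g x - f x\<bar> < \<epsilon>" for g
    proof -
      have "g x \<in> ball (f x) \<epsilon>" if "x \<in> K" for x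
        using g(2) that by (simp add: dist_real_def abs_minus_commute)
      then have "g ` K \<subseteq> U" using \<epsilon>(2) by blast
      then show ?thesis using A(1) g(1) by simp
    qed
    then show ?case using A(2) \<epsilon>(1) by (intro exI[of _ K] exI[of _ \<epsilon>]) auto
  qed
  then show thesis using that by blast
qed

text \<open>The other half: K is cut into finitely many compact pieces on which f varies little, and
  each piece contributes one subbasic condition.\<close>

lemma C_k_ball:
  assumes K: "compactin X K" and f: "f \<in> C_fun X" and "\<epsilon> > 0"
  shows "\<exists>W. openin (C_k X) W \<and> f \<in> W \<and> (\<forall>g\<in>W. \<forall>x\<in>K. \<bar>g x - f x\<bar> < \<epsilon>)"
proof -
  have cf: "continuous_map X euclideanreal f" using f by (simp add: C_fun_def)
  have "compact (f ` K)" using image_compactin[OF K cf] by simp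
  then obtain Y where Y: "finite Y" "f ` K \<subseteq> (\<Union>y\<in>Y. ball y (\<epsilon>/3))"
    using compactE_image[of "f ` K" "f ` K" "\<lambda>y. ball y (\<epsilon>/3)"] \<open>\<epsilon> > 0\<close>
    by (metis (no_types, lifting) UN_I centre_in_ball divide_pos_pos open_ball subsetI zero_less_numeral)
  \<comment> \<open>The closed ball keeps each piece compact. Its radius is smaller than
    \<epsilon>/2, so f meets the condition \<open>V y\<close>, and \<epsilon>/3 + \<epsilon>/2 stays
    below \<epsilon>.\<close>
  define L where "L y = K \<inter> {x \<in> topspace X. f x \<in> cball y (\<epsilon>/3)}" for y
  define V where "V y = {g \<in> C_fun X. g ` L y \<subseteq> ball y (\<epsilon>/2)}" for y
  have "compactin X (L y)" for y
    unfolding L_def using closedin_continuous_map_preimage[OF cf, of "cball y (\<epsilon>/3)"]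
    by (intro compact_Int_closedin[OF K]) auto
  then have "openin (C_k X) (V y)" for y
    unfolding C_k_def V_def by (intro topology_generated_by_Basis) auto
  then have "openin (C_k X) ((\<Inter>y\<in>Y. V y) \<inter> topspace (C_k X))"
    using Y by (intro openin_INT) auto
  moreover have "f \<in> (\<Inter>y\<in>Y. V y) \<inter> topspace (C_k X)"
    using f \<open>\<epsilon> > 0\<close> by (auto simp: V_def L_def topspace_C_k)
  moreover have "\<bar>g x - f x\<bar> < \<epsilon>" if g: "g \<in> (\<Inter>y\<in>Y. V y)" and x: "x \<in> K" for g x
  proof -
    obtain y where y: "y \<in> Y" "f x \<in> ball y (\<epsilon>/3)" using Y x by blast
    then have "x \<in> L y" using x compactin_subset_topspace[OF K] by (auto simp: L_def)
    moreover have "g \<in> V y" using g y by blast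
    ultimately have "g x \<in> ball y (\<epsilon>/2)" unfolding V_def by blast
    then show ?thesis using y(2) \<open>\<epsilon> > 0\<close> unfolding mem_ball dist_real_def by linarith
  qed
  ultimately show ?thesis by (intro exI[of _ "(\<Inter>y\<in>Y. V y) \<inter> topspace (C_k X)"]) blast
qed

lemma C_p_nbhd:
  assumes "openin (C_p X) W" "f \<in> W"
  obtains F \<epsilon> where "finite F" "F \<subseteq> topspace X" "\<epsilon> > 0"
    "\<forall>g\<in>C_fun X. (\<forall>x\<in>F. \<bar>g x - f x\<bar> < \<epsilon>) \<longrightarrow> g \<in> W"
proof -
  obtain V where V: "openin (product_topology (\<lambda>_. euclideanreal) (topspace X)) V" "W = V \<inter> C_fun X"
    using assms(1) by (auto simp: C_p_def openin_subtopology)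
  then obtain B where B: "f \<in> (\<Pi>\<^sub>E i\<in>topspace X. B i)" "\<And>i. open (B i)"
    "finite {i. B i \<noteq> UNIV}" "(\<Pi>\<^sub>E i\<in>topspace X. B i) \<subseteq> V"
    using product_topology_open_contains_basis[OF V(1), of f] assms(2) by auto
  define F where "F = {i \<in> topspace X. B i \<noteq> UNIV}"
  have F: "finite F" using B(3) by (simp add: F_def)
  have "\<forall>i\<in>F. \<exists>e>0. ball (f i) e \<subseteq> B i"
    using B(1,2) by (auto simp: F_def PiE_iff open_contains_ball)
  then obtain e where e: "\<And>i. i \<in> F \<Longrightarrow> e i > 0 \<and> ball (f i) (e i) \<subseteq> B i" by metis
  \<comment> \<open>The extra 1 covers an empty \<open>F\<close>.\<close>
  define \<epsilon> where "\<epsilon> = Min (insert 1 (e ` F))"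
  have \<epsilon>: "\<epsilon> > 0" "\<And>i. i \<in> F \<Longrightarrow> \<epsilon> \<le> e i" using F e by (auto simp: \<epsilon>_def)
  have "g \<in> W" if g: "g \<in> C_fun X" "\<forall>x\<in>F. \<bar>g x - f x\<bar> < \<epsilon>" for g
  proof -
    have "g i \<in> B i" if "i \<in> topspace X" for i
    proof (cases "i \<in> F")
      case True
      then have "g i \<in> ball (f i) (e i)"
        using g(2) \<epsilon>(2)[OF True] by (force simp: dist_real_def)
      then show ?thesis using e[OF True] by blast
    qed (use that in \<open>auto simp: F_def\<close>)
    then have "g \<in> (\<Pi>\<^sub>E i\<in>topspace X. B i)" using g(1) by (auto simp: C_fun_def PiE_iff)
    then show ?thesis using B(4) V(2) g(1) by blast
  qed
  then show thesis using F \<epsilon>(1) by (intro that[of F \<epsilon>]) (auto simp: F_def)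
qed

lemma openin_C_p_eval:
  assumes "x \<in> topspace X"
  shows "openin (C_p X) {f \<in> C_fun X. \<bar>f x\<bar> < c}"
proof -
  have "continuous_map (C_p X) euclideanreal (\<lambda>f. f x)"
    unfolding C_p_def using assms
    by (intro continuous_map_from_subtopology continuous_map_product_projection)
  from openin_continuous_map_preimage[OF this, of "{-c<..<c}"]
  show ?thesis by (simp add: topspace_C_p abs_less_iff conj_commute minus_less_iff)
qed

lemma openin_C_k_subbasis:
  "compactin X K \<Longrightarrow> open U \<Longrightarrow> openin (C_k X) {f \<in> C_fun X. f ` K \<subseteq> U}"
  unfolding C_k_def by (intro topology_generated_by_Basis) auto

lemma compactin_top_of_set: "compactin (top_of_set S) K \<longleftrightarrow> compact K \<and> K \<subseteq> S"
  by (auto simp: compactin_subtopology)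

section \<open>Linear maps between spaces C_p\<close>

lemma linear_C_zero:
  assumes "linear_C X Y \<phi>"
  shows "\<phi> (\<lambda>x\<in>topspace X. 0) = (\<lambda>y\<in>topspace Y. 0)"
proof -
  have "\<phi> (\<lambda>x\<in>topspace X. 0 * (\<lambda>x\<in>topspace X. 0) x) = (\<lambda>y\<in>topspace Y. 0 * \<phi> (\<lambda>x\<in>topspace X. 0) y)"
    using assms zero_C_fun[of X] unfolding linear_C_def by blast
  then show ?thesis by simp
qed

text \<open>Scaling turns control near zero into a bound for all functions. Keeping p and q abstract
  serves both directions: the surjection bounds \<open>\<phi> f t\<close> by f, the embedding bounds
  \<open>f s\<close> by \<open>\<phi> f\<close>.\<close>

lemma homogeneous_bound:
  fixes p :: "('a \<Rightarrow> real) \<Rightarrow> 'b \<Rightarrow> real" and q :: "('a \<Rightarrow> real) \<Rightarrow> real"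
  assumes p: "\<And>c f x. f \<in> C_fun X \<Longrightarrow> x \<in> F \<Longrightarrow> p (\<lambda>x\<in>topspace X. c * f x) x = c * p f x"
    and q: "\<And>c f. f \<in> C_fun X \<Longrightarrow> q (\<lambda>x\<in>topspace X. c * f x) = c * q f"
    and bd: "\<And>f. f \<in> C_fun X \<Longrightarrow> \<forall>x\<in>F. \<bar>p f x\<bar> < \<epsilon> \<Longrightarrow> \<bar>q f\<bar> < 1"
    and "\<epsilon> > 0" and f: "f \<in> C_fun X" and "R > 0" and R: "\<forall>x\<in>F. \<bar>p f x\<bar> \<le> R"
  shows "\<bar>q f\<bar> \<le> 2 / \<epsilon> * R"
proof -
  \<comment> \<open>The scaled values on F are at most \<epsilon>/2, hence strictly below
    \<epsilon>; this 2 reappears in the bound.\<close>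
  define c where "c = \<epsilon> / (2 * R)"
  have c: "c > 0" using \<open>\<epsilon> > 0\<close> \<open>R > 0\<close> by (simp add: c_def)
  have "\<bar>p (\<lambda>x\<in>topspace X. c * f x) x\<bar> < \<epsilon>" if "x \<in> F" for x
  proof -
    have "\<bar>c * p f x\<bar> \<le> c * R" using R that c by (simp add: abs_mult)
    also have "\<dots> < \<epsilon>" using \<open>\<epsilon> > 0\<close> \<open>R > 0\<close> by (simp add: c_def)
    finally show ?thesis by (simp add: p f that)
  qed
  then have "\<bar>q (\<lambda>x\<in>topspace X. c * f x)\<bar> < 1" using bd scale_C_fun[OF f] by blast
  then have "c * \<bar>q f\<bar> < 1" using c by (simp add: q f abs_mult)
  then show ?thesis using \<open>\<epsilon> > 0\<close> \<open>R > 0\<close> by (simp add: c_def field_simps)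
qed

text \<open>Continuity at zero attaches to each t in T a finite subset of S. S and T thus exchange
  roles: a function g on T that exceeds all the resulting bounds cannot be a value of
  \<phi>.\<close>

lemma no_linear_surjection_C_p:
  fixes S T :: "omega1 set"
  assumes st: "stat (S - T)" "stat (T - S)"
    and lin: "linear_C (top_of_set S) (top_of_set T) \<phi>"
    and cont: "continuous_map (C_p (top_of_set S)) (C_p (top_of_set T)) \<phi>"
  shows "\<phi> ` topspace (C_p (top_of_set S)) \<noteq> topspace (C_p (top_of_set T))"
proof
  assume surj: "\<phi> ` topspace (C_p (top_of_set S)) = topspace (C_p (top_of_set T))"
  let ?X = "top_of_set S" and ?Y = "top_of_set T"
  have "\<exists>F \<epsilon>. finite F \<and> F \<subseteq> S \<and> \<epsilon> > 0 \<and>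
      (\<forall>f\<in>C_fun ?X. (\<forall>x\<in>F. \<bar>f x\<bar> < \<epsilon>) \<longrightarrow> \<bar>\<phi> f t\<bar> < 1)" if t: "t \<in> T" for t
  proof -
    have "openin (C_p ?X) {f \<in> topspace (C_p ?X). \<phi> f \<in> {g \<in> C_fun ?Y. \<bar>g t\<bar> < 1}}"
      by (rule openin_continuous_map_preimage[OF cont openin_C_p_eval]) (use t in simp)
    moreover have "(\<lambda>x\<in>topspace ?X. 0) \<in> {f \<in> topspace (C_p ?X). \<phi> f \<in> {g \<in> C_fun ?Y. \<bar>g t\<bar> < 1}}"
      using linear_C_zero[OF lin] zero_C_fun[of ?X] zero_C_fun[of ?Y] t by (simp add: topspace_C_p)
    ultimately obtain F \<epsilon> where F: "finite F" "F \<subseteq> topspace ?X" "\<epsilon> > 0"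
      "\<forall>f\<in>C_fun ?X. (\<forall>x\<in>F. \<bar>f x - (\<lambda>x\<in>topspace ?X. 0) x\<bar> < \<epsilon>) \<longrightarrow>
        f \<in> {f \<in> topspace (C_p ?X). \<phi> f \<in> {g \<in> C_fun ?Y. \<bar>g t\<bar> < 1}}"
      by (rule C_p_nbhd)
    have "\<bar>\<phi> f t\<bar> < 1" if f: "f \<in> C_fun ?X" "\<forall>x\<in>F. \<bar>f x\<bar> < \<epsilon>" for f
    proof -
      have "\<forall>x\<in>F. \<bar>f x - (\<lambda>x\<in>topspace ?X. 0) x\<bar> < \<epsilon>" using f(2) F(2) by (simp add: subset_iff)
      then show ?thesis using F(4) f(1) by blast
    qed
    then show ?thesis using F by (intro exI[of _ F] exI[of _ \<epsilon>]) auto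
  qed
  then obtain F e where F: "\<And>t. t \<in> T \<Longrightarrow> finite (F t)" "\<And>t. t \<in> T \<Longrightarrow> F t \<subseteq> S"
    and e: "\<And>t. t \<in> T \<Longrightarrow> e t > 0"
    and Fe: "\<And>t f. t \<in> T \<Longrightarrow> f \<in> C_fun ?X \<Longrightarrow> \<forall>x\<in>F t. \<bar>f x\<bar> < e t \<Longrightarrow> \<bar>\<phi> f t\<bar> < 1"
    by metis
  have "compact (F t)" if "t \<in> T" for t using F(1)[OF that] finite_imp_compact by blast
  from function_exceeding_bounds[where F = F and M = "\<lambda>t. 2 / e t", OF st(2,1) this F(2)]
  obtain g where g: "g \<in> C_fun ?Y" "\<forall>f\<in>C_fun ?X. \<exists>t\<in>T. \<exists>R>0. (\<forall>x\<in>F t. \<bar>f x\<bar> \<le> R) \<and> 2 / e t * R < \<bar>g t\<bar>"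
    by auto
  have "g \<in> \<phi> ` C_fun ?X" using surj g(1) by (simp add: topspace_C_p)
  then obtain f where f: "f \<in> C_fun ?X" "\<phi> f = g" by blast
  obtain t R where t: "t \<in> T" "R > 0" "\<forall>x\<in>F t. \<bar>f x\<bar> \<le> R" "2 / e t * R < \<bar>\<phi> f t\<bar>"
    using g(2) f by blast
  have "\<bar>\<phi> f t\<bar> \<le> 2 / e t * R"
  proof (rule homogeneous_bound[where F = "F t" and p = "\<lambda>f. f" and q = "\<lambda>f. \<phi> f t" and X = ?X])
    show "(\<lambda>x\<in>topspace ?X. c * f x) x = c * f x" if "x \<in> F t" for c f x
      using F(2)[OF t(1)] that by auto
    show "\<phi> (\<lambda>x\<in>topspace ?X. c * f x) t = c * \<phi> f t" if "f \<in> C_fun ?X" for c f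
      using lin that t(1) by (simp add: linear_C_def)
  qed (use Fe e t f in auto)
  then show False using t(4) by simp
qed

text \<open>Here the continuity of the inverse at zero bounds \<open>f s\<close> by the values of
  \<open>\<phi> f\<close> on a finite subset of T, and a function f on S violates all these
  bounds.\<close>

lemma no_linear_embedding_C_p:
  fixes S T :: "omega1 set"
  assumes st: "stat (S - T)" "stat (T - S)"
    and lin: "linear_C (top_of_set S) (top_of_set T) \<phi>"
  shows "\<not> embedding_map (C_p (top_of_set S)) (C_p (top_of_set T)) \<phi>"
proof
  assume emb: "embedding_map (C_p (top_of_set S)) (C_p (top_of_set T)) \<phi>"
  let ?X = "top_of_set S" and ?Y = "top_of_set T"
  have hom: "homeomorphic_map (C_p ?X) (subtopology (C_p ?Y) (\<phi> ` C_fun ?X)) \<phi>"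
    using emb by (simp add: embedding_map_def topspace_C_p)
  have inj: "inj_on \<phi> (C_fun ?X)"
    using homeomorphic_imp_injective_map[OF hom] by (simp add: topspace_C_p)
  have into: "\<phi> f \<in> C_fun ?Y" if "f \<in> C_fun ?X" for f
    using homeomorphic_imp_surjective_map[OF hom] that by (auto simp: topspace_C_p)
  have "\<exists>F \<epsilon>. finite F \<and> F \<subseteq> T \<and> \<epsilon> > 0 \<and>
      (\<forall>f\<in>C_fun ?X. (\<forall>x\<in>F. \<bar>\<phi> f x\<bar> < \<epsilon>) \<longrightarrow> \<bar>f s\<bar> < 1)" if s: "s \<in> S" for s
  proof -
    have "openin (C_p ?X) {f \<in> C_fun ?X. \<bar>f s\<bar> < 1}" using openin_C_p_eval[of s ?X] s by simp
    then have "openin (subtopology (C_p ?Y) (\<phi> ` C_fun ?X)) (\<phi> ` {f \<in> C_fun ?X. \<bar>f s\<bar> < 1})"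
      using homeomorphic_imp_open_map[OF hom] by (simp add: open_map_def)
    then obtain V where V: "openin (C_p ?Y) V" "\<phi> ` {f \<in> C_fun ?X. \<bar>f s\<bar> < 1} = V \<inter> \<phi> ` C_fun ?X"
      by (auto simp: openin_subtopology)
    have "(\<lambda>x\<in>topspace ?X. 0) \<in> {f \<in> C_fun ?X. \<bar>f s\<bar> < 1}" using zero_C_fun[of ?X] s by simp
    then have "\<phi> (\<lambda>x\<in>topspace ?X. 0) \<in> V" using V(2) by blast
    then have "(\<lambda>x\<in>topspace ?Y. 0) \<in> V" by (simp only: linear_C_zero[OF lin])
    then obtain F \<epsilon> where F: "finite F" "F \<subseteq> topspace ?Y" "\<epsilon> > 0"
      "\<forall>g\<in>C_fun ?Y. (\<forall>x\<in>F. \<bar>g x - (\<lambda>x\<in>topspace ?Y. 0) x\<bar> < \<epsilon>) \<longrightarrow> g \<in> V"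
      by (rule C_p_nbhd[OF V(1)])
    have "\<bar>f s\<bar> < 1" if f: "f \<in> C_fun ?X" "\<forall>x\<in>F. \<bar>\<phi> f x\<bar> < \<epsilon>" for f
    proof -
      have "\<forall>x\<in>F. \<bar>\<phi> f x - (\<lambda>x\<in>topspace ?Y. 0) x\<bar> < \<epsilon>" using f(2) F(2) by (simp add: subset_iff)
      then have "\<phi> f \<in> \<phi> ` {f \<in> C_fun ?X. \<bar>f s\<bar> < 1}" using F(4) f(1) into V(2) by blast
      then show ?thesis using inj f(1) by (auto dest: inj_onD)
    qed
    then show ?thesis using F by (intro exI[of _ F] exI[of _ \<epsilon>]) auto
  qed
  then obtain F e where F: "\<And>s. s \<in> S \<Longrightarrow> finite (F s)" "\<And>s. s \<in> S \<Longrightarrow> F s \<subseteq> T"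
    and e: "\<And>s. s \<in> S \<Longrightarrow> e s > 0"
    and Fe: "\<And>s f. s \<in> S \<Longrightarrow> f \<in> C_fun ?X \<Longrightarrow> \<forall>x\<in>F s. \<bar>\<phi> f x\<bar> < e s \<Longrightarrow> \<bar>f s\<bar> < 1"
    by metis
  have "compact (F s)" if "s \<in> S" for s using F(1)[OF that] finite_imp_compact by blast
  from function_exceeding_bounds[where F = F and M = "\<lambda>s. 2 / e s", OF st this F(2)]
  obtain f where f: "f \<in> C_fun ?X" "\<forall>g\<in>C_fun ?Y. \<exists>s\<in>S. \<exists>R>0. (\<forall>x\<in>F s. \<bar>g x\<bar> \<le> R) \<and> 2 / e s * R < \<bar>f s\<bar>"
    by auto
  obtain s R where s: "s \<in> S" "R > 0" "\<forall>x\<in>F s. \<bar>\<phi> f x\<bar> \<le> R" "2 / e s * R < \<bar>f s\<bar>"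
    using f(2) into[OF f(1)] by blast
  have "\<bar>f s\<bar> \<le> 2 / e s * R"
  proof (rule homogeneous_bound[where F = "F s" and p = \<phi> and q = "\<lambda>f. f s" and X = ?X])
    show "\<phi> (\<lambda>x\<in>topspace ?X. c * f x) x = c * \<phi> f x" if "f \<in> C_fun ?X" "x \<in> F s" for c f x
      using lin that F(2)[OF s(1)] by (auto simp: linear_C_def)
    show "(\<lambda>x\<in>topspace ?X. c * f x) s = c * f s" for c f using s(1) by simp
  qed (use Fe e s f in auto)
  then show False using s(4) by simp
qed

section \<open>Open maps and embeddings between spaces C_k\<close>

text \<open>As \<phi> may be nonlinear, everything is measured from \<open>g0\<close>, the image of
  zero. Continuity gives the sets \<open>F s\<close>; openness makes every function near
  \<open>g0\<close> on some compact L the image of a function small on K. Adding to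
  \<open>g0\<close> a function h that vanishes on L but is 2 at s contradicts the control through
  \<open>F s\<close>.\<close>

lemma no_open_image_C_k:
  fixes S T :: "omega1 set"
  assumes st: "stat (S - T)" "stat (T - S)"
    and cont: "continuous_map (C_k (top_of_set T)) (C_k (top_of_set S)) \<phi>"
  shows "\<not> open_map (C_k (top_of_set T)) (C_k (top_of_set S)) \<phi>"
proof
  assume opn: "open_map (C_k (top_of_set T)) (C_k (top_of_set S)) \<phi>"
  let ?X = "top_of_set S" and ?Y = "top_of_set T"
  define z where "z = (\<lambda>x\<in>topspace ?Y. 0 :: real)"
  define g0 where "g0 = \<phi> z"
  have z: "z \<in> C_fun ?Y" unfolding z_def by (rule zero_C_fun)
  have zx: "z x = 0" if "x \<in> T" for x using that by (simp add: z_def)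
  have into: "\<phi> f \<in> C_fun ?X" if "f \<in> C_fun ?Y" for f
    using continuous_map_image_subset_topspace[OF cont] that by (auto simp: topspace_C_k)
  have "\<exists>F \<epsilon>. compact F \<and> F \<subseteq> T \<and> \<epsilon> > 0 \<and>
      (\<forall>f\<in>C_fun ?Y. (\<forall>x\<in>F. \<bar>f x\<bar> < \<epsilon>) \<longrightarrow> \<bar>\<phi> f s - g0 s\<bar> < 1)" if s: "s \<in> S" for s
  proof -
    define W where "W = {f \<in> topspace (C_k ?Y). \<phi> f \<in> {g \<in> C_fun ?X. g ` {s} \<subseteq> ball (g0 s) 1}}"
    have "openin (C_k ?Y) W"
      unfolding W_def
      by (rule openin_continuous_map_preimage[OF cont openin_C_k_subbasis])
        (use s in \<open>auto simp: compactin_top_of_set\<close>)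
    moreover have "z \<in> W" using z into by (simp add: W_def g0_def topspace_C_k)
    ultimately obtain F \<epsilon> where F: "compactin ?Y F" "\<epsilon> > 0"
      "\<forall>f\<in>C_fun ?Y. (\<forall>x\<in>F. \<bar>f x - z x\<bar> < \<epsilon>) \<longrightarrow> f \<in> W"
      by (rule C_k_nbhd)
    have FT: "compact F" "F \<subseteq> T" using F(1) by (auto simp: compactin_top_of_set)
    have "\<bar>\<phi> f s - g0 s\<bar> < 1" if f: "f \<in> C_fun ?Y" "\<forall>x\<in>F. \<bar>f x\<bar> < \<epsilon>" for f
    proof -
      have "f \<in> W" using F(3) f FT(2) zx by (metis diff_zero subsetD)
      then show ?thesis by (auto simp: W_def dist_real_def)
    qed
    then show ?thesis using F(2) FT by (intro exI[of _ F] exI[of _ \<epsilon>]) auto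
  qed
  then obtain F e where F: "\<And>s. s \<in> S \<Longrightarrow> compact (F s)" "\<And>s. s \<in> S \<Longrightarrow> F s \<subseteq> T"
    and e: "\<And>s. s \<in> S \<Longrightarrow> e s > 0"
    and Fe: "\<And>s f. s \<in> S \<Longrightarrow> f \<in> C_fun ?Y \<Longrightarrow> \<forall>x\<in>F s. \<bar>f x\<bar> < e s \<Longrightarrow> \<bar>\<phi> f s - g0 s\<bar> < 1"
    by metis
  obtain K \<epsilon> where K: "compact K" "K \<subseteq> T" "\<epsilon> > 0"
    and *: "\<forall>L. compact L \<and> L \<subseteq> S \<longrightarrow> (\<exists>(h :: omega1 \<Rightarrow> real) s. continuous_on S h \<and>
       (\<forall>x\<in>L. h x = 0) \<and> s \<in> S \<and> h s = 2 \<and> F s \<subseteq> K \<and> \<epsilon> \<le> e s)"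
    using st F e by (rule compact_not_controlling)
  define W where "W = {f \<in> C_fun ?Y. f ` K \<subseteq> ball 0 \<epsilon>}"
  have "openin (C_k ?Y) W"
    unfolding W_def by (rule openin_C_k_subbasis) (use K in \<open>auto simp: compactin_top_of_set\<close>)
  then have "openin (C_k ?X) (\<phi> ` W)" using opn by (simp add: open_map_def)
  moreover have "z \<in> W" using z zx K by (auto simp: W_def)
  then have "g0 \<in> \<phi> ` W" unfolding g0_def by (rule imageI)
  ultimately obtain L \<eta> where L: "compactin ?X L" "\<eta> > 0"
    "\<forall>g\<in>C_fun ?X. (\<forall>x\<in>L. \<bar>g x - g0 x\<bar> < \<eta>) \<longrightarrow> g \<in> \<phi> ` W"
    by (rule C_k_nbhd)
  have LS: "compact L" "L \<subseteq> S" using L(1) by (auto simp: compactin_top_of_set)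
  then obtain h s where h: "continuous_on S h" "\<forall>x\<in>L. h x = (0::real)" "s \<in> S" "h s = 2" "F s \<subseteq> K" "\<epsilon> \<le> e s"
    using * by blast
  have g0: "continuous_on S g0" using into[OF z] by (simp add: g0_def C_fun_top_of_set)
  define g where "g = (\<lambda>x\<in>S. g0 x + h x)"
  have "g \<in> C_fun ?X" unfolding g_def by (intro restrict_C_fun continuous_on_add g0 h)
  moreover have "\<forall>x\<in>L. \<bar>g x - g0 x\<bar> < \<eta>" using LS L(2) h(2) by (auto simp: g_def)
  ultimately obtain f where f: "f \<in> W" "g = \<phi> f" using L(3) by blast
  have "\<forall>x\<in>F s. \<bar>f x\<bar> < e s" using f(1) h(5,6) by (force simp: W_def image_subset_iff)
  then have "\<bar>g s - g0 s\<bar> < 1" using Fe[OF h(3)] f by (auto simp: W_def)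
  then show False using h by (simp add: g_def)
qed

text \<open>The two directions are exchanged: continuity of the inverse gives the sets
  \<open>F s\<close>, and continuity of \<phi> gives L. The image of h is within \<epsilon> of
  \<open>g0\<close> on K, which forces \<open>h s\<close> below 1.\<close>

lemma no_embedding_C_k:
  fixes S T :: "omega1 set"
  assumes st: "stat (S - T)" "stat (T - S)"
  shows "\<not> embedding_map (C_k (top_of_set S)) (C_k (top_of_set T)) \<phi>"
proof
  assume emb: "embedding_map (C_k (top_of_set S)) (C_k (top_of_set T)) \<phi>"
  let ?X = "top_of_set S" and ?Y = "top_of_set T"
  have hom: "homeomorphic_map (C_k ?X) (subtopology (C_k ?Y) (\<phi> ` C_fun ?X)) \<phi>"
    using emb by (simp add: embedding_map_def topspace_C_k)
  have inj: "inj_on \<phi> (C_fun ?X)"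
    using homeomorphic_imp_injective_map[OF hom] by (simp add: topspace_C_k)
  have cont: "continuous_map (C_k ?X) (C_k ?Y) \<phi>"
    using homeomorphic_imp_continuous_map[OF hom] continuous_map_into_fulltopology by blast
  have into: "\<phi> f \<in> C_fun ?Y" if "f \<in> C_fun ?X" for f
    using continuous_map_image_subset_topspace[OF cont] that by (auto simp: topspace_C_k)
  define z where "z = (\<lambda>x\<in>topspace ?X. 0 :: real)"
  define g0 where "g0 = \<phi> z"
  have z: "z \<in> C_fun ?X" unfolding z_def by (rule zero_C_fun)
  have zx: "z x = 0" if "x \<in> S" for x using that by (simp add: z_def)
  have "\<exists>F \<epsilon>. compact F \<and> F \<subseteq> T \<and> \<epsilon> > 0 \<and>
      (\<forall>f\<in>C_fun ?X. (\<forall>x\<in>F. \<bar>\<phi> f x - g0 x\<bar> < \<epsilon>) \<longrightarrow> \<bar>f s\<bar> < 1)" if s: "s \<in> S" for s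
  proof -
    define W where "W = {f \<in> C_fun ?X. f ` {s} \<subseteq> ball 0 1}"
    have "openin (C_k ?X) W"
      unfolding W_def by (rule openin_C_k_subbasis) (use s in \<open>auto simp: compactin_top_of_set\<close>)
    then have "openin (subtopology (C_k ?Y) (\<phi> ` C_fun ?X)) (\<phi> ` W)"
      using homeomorphic_imp_open_map[OF hom] by (simp add: open_map_def)
    then obtain V where V: "openin (C_k ?Y) V" "\<phi> ` W = V \<inter> \<phi> ` C_fun ?X"
      by (auto simp: openin_subtopology)
    have "z \<in> W" using z zx s by (simp add: W_def)
    then have "g0 \<in> V" using V(2) by (auto simp: g0_def)
    then obtain F \<epsilon> where F: "compactin ?Y F" "\<epsilon> > 0"
      "\<forall>g\<in>C_fun ?Y. (\<forall>x\<in>F. \<bar>g x - g0 x\<bar> < \<epsilon>) \<longrightarrow> g \<in> V"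
      by (rule C_k_nbhd[OF V(1)])
    have "\<bar>f s\<bar> < 1" if f: "f \<in> C_fun ?X" "\<forall>x\<in>F. \<bar>\<phi> f x - g0 x\<bar> < \<epsilon>" for f
    proof -
      have "\<phi> f \<in> \<phi> ` W" using F(3) f into V(2) by blast
      then have "f \<in> W" using inj f(1) by (auto simp: W_def dest: inj_onD)
      then show ?thesis by (simp add: W_def)
    qed
    then show ?thesis
      using F by (intro exI[of _ F] exI[of _ \<epsilon>]) (auto simp: compactin_top_of_set)
  qed
  then obtain F e where F: "\<And>s. s \<in> S \<Longrightarrow> compact (F s)" "\<And>s. s \<in> S \<Longrightarrow> F s \<subseteq> T"
    and e: "\<And>s. s \<in> S \<Longrightarrow> e s > 0"
    and Fe: "\<And>s f. s \<in> S \<Longrightarrow> f \<in> C_fun ?X \<Longrightarrow> \<forall>x\<in>F s. \<bar>\<phi> f x - g0 x\<bar> < e s \<Longrightarrow> \<bar>f s\<bar> < 1"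
    by metis
  obtain K \<epsilon> where K: "compact K" "K \<subseteq> T" "\<epsilon> > 0"
    and *: "\<forall>L. compact L \<and> L \<subseteq> S \<longrightarrow> (\<exists>(h :: omega1 \<Rightarrow> real) s. continuous_on S h \<and>
       (\<forall>x\<in>L. h x = 0) \<and> s \<in> S \<and> h s = 2 \<and> F s \<subseteq> K \<and> \<epsilon> \<le> e s)"
    using st F e by (rule compact_not_controlling)
  have "compactin ?Y K" using K by (simp add: compactin_top_of_set)
  \<comment> \<open>Around \<open>g0\<close>, which need not be constant on K, a single subbasic set
    would not express uniform closeness.\<close>
  from C_k_ball[OF this into[OF z] K(3)]
  obtain W where W: "openin (C_k ?Y) W" "g0 \<in> W" "\<forall>g\<in>W. \<forall>x\<in>K. \<bar>g x - g0 x\<bar> < \<epsilon>"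
    by (auto simp: g0_def)
  have "openin (C_k ?X) {f \<in> topspace (C_k ?X). \<phi> f \<in> W}"
    by (rule openin_continuous_map_preimage[OF cont W(1)])
  moreover have "z \<in> {f \<in> topspace (C_k ?X). \<phi> f \<in> W}"
    using z W(2) by (simp add: topspace_C_k g0_def)
  ultimately obtain L \<eta> where L: "compactin ?X L" "\<eta> > 0"
    "\<forall>f\<in>C_fun ?X. (\<forall>x\<in>L. \<bar>f x - z x\<bar> < \<eta>) \<longrightarrow> f \<in> {f \<in> topspace (C_k ?X). \<phi> f \<in> W}"
    by (rule C_k_nbhd)
  have LS: "compact L" "L \<subseteq> S" using L(1) by (auto simp: compactin_top_of_set)
  then obtain h s where h: "continuous_on S h" "\<forall>x\<in>L. h x = (0::real)" "s \<in> S" "h s = 2" "F s \<subseteq> K" "\<epsilon> \<le> e s"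
    using * by blast
  have hC: "restrict h S \<in> C_fun ?X" by (rule restrict_C_fun[OF h(1)])
  moreover have "\<forall>x\<in>L. \<bar>restrict h S x - z x\<bar> < \<eta>" using LS L(2) h(2) zx by (auto simp: subset_iff)
  ultimately have "\<phi> (restrict h S) \<in> W" using L(3) by blast
  then have "\<forall>x\<in>F s. \<bar>\<phi> (restrict h S) x - g0 x\<bar> < e s" using W(3) h(5,6) by (meson order_less_le_trans subsetD)
  then have "\<bar>restrict h S s\<bar> < 1" using Fe[OF h(3) hC] by blast
  then show False using h by simp
qed

theorem corollary37:
  shows "\<exists>\<A> :: omega1 set set.
    |\<A>| =o ctwo ^c |UNIV :: omega1 set| \<and>
    (\<forall>S\<in>\<A>. \<forall>T\<in>\<A>. S \<noteq> T \<longrightarrow>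
      \<not> (\<exists>\<phi>. continuous_map (C_k (top_of_set T)) (C_k (top_of_set S)) \<phi> \<and>
             open_map (C_k (top_of_set T)) (C_k (top_of_set S)) \<phi> \<and>
             \<phi> ` topspace (C_k (top_of_set T)) = topspace (C_k (top_of_set S))) \<and>
      \<not> (\<exists>\<phi>. embedding_map (C_k (top_of_set S)) (C_k (top_of_set T)) \<phi>)) \<and>
    (\<forall>S\<in>\<A>. \<forall>T\<in>\<A>. S \<noteq> T \<longrightarrow>
      \<not> (\<exists>\<phi>. linear_C (top_of_set S) (top_of_set T) \<phi> \<and>
             continuous_map (C_p (top_of_set S)) (C_p (top_of_set T)) \<phi> \<and>
             \<phi> ` topspace (C_p (top_of_set S)) = topspace (C_p (top_of_set T))) \<and>
      \<not> (\<exists>\<phi>. linear_C (top_of_set S) (top_of_set T) \<phi> \<and>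
             embedding_map (C_p (top_of_set S)) (C_p (top_of_set T)) \<phi>))"
proof -
  obtain \<A> :: "omega1 set set" where \<A>: "|\<A>| =o ctwo ^c |UNIV :: omega1 set|"
    "\<forall>S\<in>\<A>. \<forall>T\<in>\<A>. S \<noteq> T \<longrightarrow> stat (S - T)"
    by (rule stationary_antichain)
  have st: "stat (S - T)" "stat (T - S)" if "S \<in> \<A>" "T \<in> \<A>" "S \<noteq> T" for S T
    using \<A>(2) that by (blast, metis)
  show ?thesis
  proof (intro exI[of _ \<A>] conjI \<A>(1) ballI impI)
    fix S T assume "S \<in> \<A>" "T \<in> \<A>" "S \<noteq> T"
    then have ST: "stat (S - T)" "stat (T - S)" by (rule st)+
    show "\<not> (\<exists>\<phi>. continuous_map (C_k (top_of_set T)) (C_k (top_of_set S)) \<phi> \<and>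
             open_map (C_k (top_of_set T)) (C_k (top_of_set S)) \<phi> \<and>
             \<phi> ` topspace (C_k (top_of_set T)) = topspace (C_k (top_of_set S)))"
      using no_open_image_C_k[OF ST] by metis
    show "\<not> (\<exists>\<phi>. embedding_map (C_k (top_of_set S)) (C_k (top_of_set T)) \<phi>)"
      using no_embedding_C_k[OF ST] by metis
    show "\<not> (\<exists>\<phi>. linear_C (top_of_set S) (top_of_set T) \<phi> \<and>
             continuous_map (C_p (top_of_set S)) (C_p (top_of_set T)) \<phi> \<and>
             \<phi> ` topspace (C_p (top_of_set S)) = topspace (C_p (top_of_set T)))"
      using no_linear_surjection_C_p[OF ST] by metis
    show "\<not> (\<exists>\<phi>. linear_C (top_of_set S) (top_of_set T) \<phi> \<and>
             embedding_map (C_p (top_of_set S)) (C_p (top_of_set T)) \<phi>)"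
      using no_linear_embedding_C_p[OF ST] by metis
  qed
qed

end
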